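(* Let $\mathcal{T}$ be a topology on a finite set $X$. For any subset $W\subset X$ and for any $\mathcal{T}$-admissible topology $\mathcal{T}'$ on $X$, the restriction $\mathcal{T}'_{|W}$ is $\mathcal{T}_{|W}$-admissible.
   Context: A topology on a finite set $X$ is identified with its family $\mathcal{T}$ of open subsets. It corresponds bijectively to a quasi-order: $x\le_{\mathcal{T}}y$ iff every open subset containing $x$ contains $y$ (open subsets are the upper ideals). Put $x\sim_{\mathcal{T}}y$ iff $x\le_{\mathcal{T}}y$ and $y\le_{\mathcal{T}}x$. For $Y\subset X$, $\mathcal{T}_{|Y}=\{Z\cap Y:Z\in\mathcal{T}\}$. For topologies on the same set $X$, $\mathcal{T}'$ is finer than $\mathcal{T}$, written $\mathcal{T}'\prec\mathcal{T}$, if every $\mathcal{T}$-open set is $\mathcal{T}'$-open (equivalently $x\le_{\mathcal{T}'}y\Rightarrow x\le_{\mathcal{T}}y$; equality is allowed). If $\mathcal{T}'\prec\mathcal{T}$, the quotient $\mathcal{T}/\mathcal{T}'$ is the topology on $X$ whose quasi-order is the transitive closure of the relation: $x\le_{\mathcal{T}}y$ or $y\le_{\mathcal{T}'}x$. The topology $\mathcal{T}'$ is $\mathcal{T}$-admissible if: (i) $\mathcal{T}'\prec\mathcal{T}$; (ii) $\mathcal{T}'_{|Y}=\mathcal{T}_{|Y}$ for every $Y\subset X$ connected for $\mathcal{T}'$; (iii) for all $x,y\in X$, $x\sim_{\mathcal{T}/\mathcal{T}'}y\iff x\sim_{\mathcal{T}'/\mathcal{T}'}y$. *)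

theory Defs
  imports "HOL-Analysis.Abstract_Topology"
begin

(* A topology on a finite set X is a term T :: 'a topology with topspace T = X and X finite.
   The orientation makes the open sets the upper ideals; points outside the carrier are
   unrelated. *)
definition top_le :: "'a topology \<Rightarrow> 'a \<Rightarrow> 'a \<Rightarrow> bool" where
  "top_le T x y \<longleftrightarrow>
     x \<in> topspace T \<and> y \<in> topspace T \<and> (\<forall>U. openin T U \<and> x \<in> U \<longrightarrow> y \<in> U)"

definition top_equiv :: "'a topology \<Rightarrow> 'a \<Rightarrow> 'a \<Rightarrow> bool" where
  "top_equiv T x y \<longleftrightarrow> top_le T x y \<and> top_le T y x"

definition finer :: "'a topology \<Rightarrow> 'a topology \<Rightarrow> bool" where
  "finer T' T \<longleftrightarrow> topspace T' = topspace T \<and> (\<forall>U. openin T U \<longrightarrow> openin T' U)"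

definition upper_ideal_topology :: "'a set \<Rightarrow> ('a \<Rightarrow> 'a \<Rightarrow> bool) \<Rightarrow> 'a topology" where
  "upper_ideal_topology X R =
     topology (\<lambda>U. U \<subseteq> X \<and> (\<forall>x\<in>U. \<forall>y\<in>X. R x y \<longrightarrow> y \<in> U))"

lemma openin_upper_ideal_topology:
  "openin (upper_ideal_topology X R) U \<longleftrightarrow> U \<subseteq> X \<and> (\<forall>x\<in>U. \<forall>y\<in>X. R x y \<longrightarrow> y \<in> U)"
proof -
  have "istopology (\<lambda>U. U \<subseteq> X \<and> (\<forall>x\<in>U. \<forall>y\<in>X. R x y \<longrightarrow> y \<in> U))"
    unfolding istopology_def by blast
  then show ?thesis
    by (simp add: upper_ideal_topology_def topology_inverse')
qed

lemma topspace_upper_ideal_topology [simp]: "topspace (upper_ideal_topology X R) = X"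
  unfolding topspace_def openin_upper_ideal_topology by blast

(* The next two lemmas are the bijection between quasi-orders on a finite set X and
   topologies on X. *)
lemma top_le_upper_ideal_topology:
  assumes "\<And>x. x \<in> X \<Longrightarrow> R x x"
    and "\<And>x y z. R x y \<Longrightarrow> R y z \<Longrightarrow> R x z"
  shows "top_le (upper_ideal_topology X R) x y \<longleftrightarrow> x \<in> X \<and> y \<in> X \<and> R x y"
proof
  assume L: "top_le (upper_ideal_topology X R) x y"
  then have xy: "x \<in> X" "y \<in> X"
    by (auto simp: top_le_def)
  have "openin (upper_ideal_topology X R) {z \<in> X. R x z}"
    using assms(2) by (auto simp: openin_upper_ideal_topology)
  then show "x \<in> X \<and> y \<in> X \<and> R x y"
    using L xy assms(1) unfolding top_le_def by blast
next
  assume "x \<in> X \<and> y \<in> X \<and> R x y"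
  then show "top_le (upper_ideal_topology X R) x y"
    by (auto simp: top_le_def openin_upper_ideal_topology)
qed

lemma upper_ideal_topology_top_le:
  assumes "finite (topspace T)"
  shows "upper_ideal_topology (topspace T) (top_le T) = T"
proof -
  have "openin T U" if U: "U \<subseteq> topspace T"
      and up: "\<forall>x\<in>U. \<forall>y\<in>topspace T. top_le T x y \<longrightarrow> y \<in> U" for U
  proof (subst openin_subopen, intro ballI)
    fix x assume x: "x \<in> U"
    let ?F = "{V. openin T V \<and> x \<in> V}"
    have "?F \<subseteq> Pow (topspace T)"
      by (auto dest: openin_subset)
    then have fin: "finite ?F"
      using assms finite_subset by blast
    have ne: "topspace T \<in> ?F"
      using x U by auto
    have "openin T (\<Inter>?F)"
      using fin ne by (intro openin_Inter) auto
    moreover have "\<Inter>?F \<subseteq> U"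
    proof
      fix y assume y: "y \<in> \<Inter>?F"
      then have "y \<in> topspace T"
        using ne by blast
      then have "top_le T x y"
        using x U y by (auto simp: top_le_def)
      then show "y \<in> U"
        using up x \<open>y \<in> topspace T\<close> by blast
    qed
    ultimately show "\<exists>V. openin T V \<and> x \<in> V \<and> V \<subseteq> U"
      by blast
  qed
  moreover have "U \<subseteq> topspace T \<and> (\<forall>x\<in>U. \<forall>y\<in>topspace T. top_le T x y \<longrightarrow> y \<in> U)"
    if "openin T U" for U
    using that openin_subset[OF that] by (auto simp: top_le_def)
  ultimately show ?thesis
    unfolding topology_eq openin_upper_ideal_topology by meson
qed

definition quot_top :: "'a topology \<Rightarrow> 'a topology \<Rightarrow> 'a topology" where
  "quot_top T T' =
     upper_ideal_topology (topspace T) ((\<lambda>x y. top_le T x y \<or> top_le T' y x)\<^sup>+\<^sup>+)"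

lemma topspace_quot_top [simp]: "topspace (quot_top T T') = topspace T"
  by (simp add: quot_top_def)

lemma top_le_quot_top:
  assumes "finer T' T"
  shows "top_le (quot_top T T') x y \<longleftrightarrow> (\<lambda>x y. top_le T x y \<or> top_le T' y x)\<^sup>+\<^sup>+ x y"
proof -
  let ?R = "\<lambda>x y. top_le T x y \<or> top_le T' y x"
  have step: "u \<in> topspace T \<and> v \<in> topspace T" if "?R u v" for u v
    using that assms by (auto simp: top_le_def finer_def)
  have "u \<in> topspace T \<and> v \<in> topspace T" if "?R\<^sup>+\<^sup>+ u v" for u v
    using that by (induction rule: tranclp_induct) (meson step)+
  moreover have "?R\<^sup>+\<^sup>+ u u" if "u \<in> topspace T" for u
    using that by (intro tranclp.r_into_trancl) (auto simp: top_le_def)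
  ultimately show ?thesis
    unfolding quot_top_def
    using top_le_upper_ideal_topology[of "topspace T" "?R\<^sup>+\<^sup>+" x y] tranclp_trans[of ?R] by blast
qed

(* admissible T T' reads: T' is T-admissible. *)
definition admissible :: "'a topology \<Rightarrow> 'a topology \<Rightarrow> bool" where
  "admissible T T' \<longleftrightarrow>
     finer T' T \<and>
     (\<forall>Y. Y \<subseteq> topspace T \<and> connectedin T' Y \<longrightarrow> subtopology T' Y = subtopology T Y) \<and>
     (\<forall>x\<in>topspace T. \<forall>y\<in>topspace T.
        top_equiv (quot_top T T') x y \<longleftrightarrow> top_equiv (quot_top T' T') x y)"

end

theory Submission
  imports Defs "HOL-Analysis.Abstract_Topology_2"
begin

text \<open>
  The \<open>T'\<close>-components are the classes of the quotient \<open>T' / T'\<close>, and by admissibility they are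
  also the classes of \<open>T / T'\<close>. A \<open>T\<close>-relation between two points of one component is a
  \<open>T'\<close>-relation, because the component is \<open>T'\<close>-connected. Hence every step of a cycle of the
  relation defining \<open>T / T'\<close> is, up to orientation, a \<open>T'\<close>-relation. A cycle inside \<open>W\<close>
  therefore becomes a \<open>T'\<close>-zigzag inside \<open>W\<close>, with the same vertices.
\<close>

abbreviation quot_step :: "'a topology \<Rightarrow> 'a topology \<Rightarrow> 'a \<Rightarrow> 'a \<Rightarrow> bool" where
  "quot_step T T' \<equiv> \<lambda>x y. top_le T x y \<or> top_le T' y x"

text \<open>Each step of the path from \<open>x\<close> to \<open>y\<close> lies on a closed walk:
  its return path runs on to \<open>y\<close>, back to \<open>x\<close> and along the path up to the
  step. The return path is kept as a premise of the induction, since it changes with the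
  endpoint.\<close>

lemma tranclp_cycle:
  assumes "R\<^sup>+\<^sup>+ x y" and "R\<^sup>+\<^sup>+ y x"
    and cyclic: "\<And>u v. R u v \<Longrightarrow> R\<^sup>+\<^sup>+ v u \<Longrightarrow> S u v"
  shows "S\<^sup>+\<^sup>+ x y"
  using assms(1,2)
proof (induction rule: tranclp_induct)
  case (base y)
  then show ?case
    by (rule cyclic[THEN tranclp.r_into_trancl[of S]])
next
  case (step y z)
  have "R\<^sup>+\<^sup>+ y x"
    using step.hyps(2) step.prems by (rule tranclp_into_tranclp2)
  then have "S\<^sup>+\<^sup>+ x y"
    by (rule step.IH)
  moreover have "S y z"
    using step.hyps(2) tranclp_trans[OF step.prems step.hyps(1)] by (rule cyclic)
  ultimately show ?case
    by (rule tranclp.trancl_into_trancl)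
qed

lemma tranclp_mono:
  assumes "R\<^sup>+\<^sup>+ x y" and mono: "\<And>u v. R u v \<Longrightarrow> S u v"
  shows "S\<^sup>+\<^sup>+ x y"
  using assms(1)
proof (induction rule: tranclp_induct)
  case (base y)
  then show ?case
    by (rule mono[THEN tranclp.r_into_trancl[of S]])
next
  case (step y z)
  then show ?case
    using mono tranclp.trancl_into_trancl by metis
qed

lemma top_le_subtopology:
  "top_le (subtopology T W) x y \<longleftrightarrow> x \<in> W \<and> y \<in> W \<and> top_le T x y"
  by (auto simp: top_le_def openin_subtopology_alt)

lemma finer_subtopology: "finer T' T \<Longrightarrow> finer (subtopology T' W) (subtopology T W)"
  by (auto simp: finer_def openin_subtopology)

lemma finer_top_le: "finer T' T \<Longrightarrow> top_le T' x y \<Longrightarrow> top_le T x y"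
  by (auto simp: finer_def top_le_def)

lemma finer_refl: "finer T T"
  by (simp add: finer_def)

text \<open>An open set around \<open>x\<close> also contains \<open>y\<close>, so no two open sets
  can separate \<open>{x, y}\<close>.\<close>

lemma top_le_imp_connected_component_of:
  assumes "top_le T x y"
  shows "connected_component_of T x y"
proof -
  have "connectedin T {x, y}"
    using assms unfolding connectedin top_le_def by blast
  then show ?thesis
    unfolding connected_component_of_def by blast
qed

lemma quot_step_self_imp_connected_component_of:
  assumes "(quot_step T T)\<^sup>+\<^sup>+ x y"
  shows "connected_component_of T x y"
  using assms
  by (induction rule: tranclp_induct)
    (meson top_le_imp_connected_component_of connected_component_of_sym connected_component_of_trans)+

lemma admissible_top_le_if_quot:
  assumes adm: "admissible T T'"
    and uv: "top_le T u v" and vu: "(quot_step T T')\<^sup>+\<^sup>+ v u"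
  shows "top_le T' u v"
proof -
  have fin: "finer T' T"
    using adm by (simp add: admissible_def)
  have in_top: "u \<in> topspace T" "v \<in> topspace T"
    using uv by (auto simp: top_le_def)
  have "top_equiv (quot_top T T') u v"
    using uv vu by (auto simp: top_equiv_def top_le_quot_top[OF fin])
  then have "top_equiv (quot_top T' T') u v"
    using adm in_top by (auto simp: admissible_def)
  then have "(quot_step T' T')\<^sup>+\<^sup>+ u v"
    by (simp add: top_equiv_def top_le_quot_top[OF finer_refl])
  then obtain Y where Y: "connectedin T' Y" "u \<in> Y" "v \<in> Y"
    by (metis quot_step_self_imp_connected_component_of connected_component_of_def)
  moreover have "Y \<subseteq> topspace T"
    using connectedin_subset_topspace[OF Y(1)] fin by (simp add: finer_def)
  ultimately have "subtopology T' Y = subtopology T Y"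
    using adm by (auto simp: admissible_def)
  then show ?thesis
    using uv Y by (metis top_le_subtopology)
qed

theorem proposition3p2:
  fixes X W :: "'a set" and T T' :: "'a topology"
  assumes "finite X"
    and "topspace T = X"
    and "W \<subseteq> X"
    and "topspace T' = X"
    and "admissible T T'"
  shows "admissible (subtopology T W) (subtopology T' W)"
proof -
  let ?S = "subtopology T W" and ?S' = "subtopology T' W"
  let ?R = "quot_step ?S ?S'" and ?R' = "quot_step ?S' ?S'"
  have fin: "finer T' T"
    using assms(5) by (simp add: admissible_def)
  have finS: "finer ?S' ?S"
    using fin by (rule finer_subtopology)
  have conn: "subtopology ?S' Y = subtopology ?S Y"
    if "Y \<subseteq> topspace ?S" "connectedin ?S' Y" for Y
  proof -
    have "Y \<subseteq> W" "Y \<subseteq> topspace T" "connectedin T' Y"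
      using that by (auto simp: connectedin_subtopology)
    then show ?thesis
      \<comment> \<open>As \<open>Y\<close> lies in \<open>W\<close>, restricting to
        \<open>W\<close> and then to \<open>Y\<close> is restricting to \<open>Y\<close>.\<close>
      using assms(5) by (simp add: admissible_def subtopology_subtopology Int_absorb1)
  qed
  \<comment> \<open>Only a step coming from \<open>T\<close> needs the return path; a reversed
    \<open>T'\<close>-step is already a step of \<open>?R'\<close>.\<close>
  have zigzag: "?R' u v" if uv: "?R u v" and vu: "?R\<^sup>+\<^sup>+ v u" for u v
  proof -
    have "(quot_step T T')\<^sup>+\<^sup>+ v u"
      using vu by (rule tranclp_mono) (auto simp: top_le_subtopology)
    then show ?thesis
      using uv admissible_top_le_if_quot[OF assms(5), of u v]
      by (auto simp: top_le_subtopology)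
  qed
  have forward: "?R'\<^sup>+\<^sup>+ x y" if "?R\<^sup>+\<^sup>+ x y" "?R\<^sup>+\<^sup>+ y x" for x y
    using that zigzag by (rule tranclp_cycle)
  \<comment> \<open>No cycle is required in this direction: by fineness every single step of
    \<open>?R'\<close> is one of \<open>?R\<close>.\<close>
  have backward: "?R\<^sup>+\<^sup>+ x y" if "?R'\<^sup>+\<^sup>+ x y" for x y
    using that by (rule tranclp_mono) (auto dest: finer_top_le[OF finS])
  have "top_equiv (quot_top ?S ?S') x y \<longleftrightarrow> top_equiv (quot_top ?S' ?S') x y" for x y
    using forward[of x y] forward[of y x] backward[of x y] backward[of y x]
    unfolding top_equiv_def top_le_quot_top[OF finS] top_le_quot_top[OF finer_refl] by argo
  then show ?thesis
    using finS conn by (simp add: admissible_def)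
qed

end
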